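(* Let $\mathbb{K}$ be an algebraically closed field of characteristic zero, let $\mathfrak{g}$ be an $m$-dimensional Lie algebra over $\mathbb{K}$ which is non-perfect (i.e. $[\mathfrak{g},\mathfrak{g}]\ne\mathfrak{g}$), and let $\mathfrak{a}_l$ denote the $l$-dimensional abelian Lie algebra. Then the direct sum of Lie algebras $\mathfrak{g}\oplus\mathfrak{a}_l$ is non-rigid in $\mathcal{L}_{m+l}$ for every integer $l\ge 1$.
   Context: $\mathcal{L}_n$ is the affine algebraic variety (with Zariski topology) of all Lie brackets $\mu:\mathbb{K}^n\times\mathbb{K}^n\to\mathbb{K}^n$ (antisymmetric bilinear maps satisfying the Jacobi identity). $\operatorname{GL}_n(\mathbb{K})$ acts by change of basis, $(g\cdot\mu)(x,y)=g\mu(g^{-1}x,g^{-1}y)$, and the orbits are the isomorphism classes. A Lie bracket $\mu$ is rigid in $\mathcal{L}_n$ if its orbit is Zariski open in $\mathcal{L}_n$; otherwise it is non-rigid. A Lie algebra of dimension $n$ is identified with its bracket via any choice of basis. *)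

theory Defs
  imports "HOL-Analysis.Analysis" "HOL-Computational_Algebra.Polynomial"
begin

section \<open>Lie algebras over a field\<close>

locale lie_algebra = vector_space scale
  for scale :: "'k::field \<Rightarrow> 'v::ab_group_add \<Rightarrow> 'v" +
  fixes bracket :: "'v \<Rightarrow> 'v \<Rightarrow> 'v"
  assumes linear_left: "\<And>y. Vector_Spaces.linear scale scale (\<lambda>x. bracket x y)"
    and linear_right: "\<And>x. Vector_Spaces.linear scale scale (\<lambda>y. bracket x y)"
    and antisym: "\<And>x y. bracket x y = - bracket y x"
    and jacobi: "\<And>x y z. bracket x (bracket y z) + bracket y (bracket z x) + bracket z (bracket x y) = 0"

definition has_dimension :: "('k::field \<Rightarrow> 'v::ab_group_add \<Rightarrow> 'v) \<Rightarrow> nat \<Rightarrow> bool"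
  where "has_dimension s n \<longleftrightarrow>
    (\<exists>B. finite_dimensional_vector_space s B \<and> card B = n)"

definition derived_algebra ::
    "('k::field \<Rightarrow> 'v::ab_group_add \<Rightarrow> 'v) \<Rightarrow> ('v \<Rightarrow> 'v \<Rightarrow> 'v) \<Rightarrow> 'v set"
  where "derived_algebra s b = module.span s {b x y | x y. True}"

definition perfect ::
    "('k::field \<Rightarrow> 'v::ab_group_add \<Rightarrow> 'v) \<Rightarrow> ('v \<Rightarrow> 'v \<Rightarrow> 'v) \<Rightarrow> bool"
  where "perfect s b \<longleftrightarrow> derived_algebra s b = UNIV"

definition abelian :: "('v \<Rightarrow> 'v \<Rightarrow> 'v::zero) \<Rightarrow> bool"
  where "abelian b \<longleftrightarrow> (\<forall>x y. b x y = 0)"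

definition direct_sum_bracket ::
    "('v \<Rightarrow> 'v \<Rightarrow> 'v) \<Rightarrow> ('w \<Rightarrow> 'w \<Rightarrow> 'w) \<Rightarrow> 'v \<times> 'w \<Rightarrow> 'v \<times> 'w \<Rightarrow> 'v \<times> 'w"
  where "direct_sum_bracket b c u v = (b (fst u) (fst v), c (snd u) (snd v))"

text \<open>
  Choosing a basis of an \<open>n\<close>-dimensional space amounts to choosing a linear coordinate
  isomorphism onto \<open>K\<^sup>n\<close>; \<open>bracket_in_coordinates\<close> carries a bracket along it.
\<close>

definition coordinate_iso ::
    "('k::field \<Rightarrow> 'v::ab_group_add \<Rightarrow> 'v) \<Rightarrow> ('v \<Rightarrow> 'k ^ 'n) \<Rightarrow> bool"
  where "coordinate_iso s \<phi> \<longleftrightarrow> Vector_Spaces.linear s (*s) \<phi> \<and> bij \<phi>"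

definition bracket_in_coordinates ::
    "('v \<Rightarrow> 'k ^ 'n) \<Rightarrow> ('v \<Rightarrow> 'v \<Rightarrow> 'v) \<Rightarrow> 'k ^ 'n \<Rightarrow> 'k ^ 'n \<Rightarrow> 'k ^ 'n"
  where "bracket_in_coordinates \<phi> b x y = \<phi> (b (inv \<phi> x) (inv \<phi> y))"


section \<open>The Zariski topology on affine space\<close>

text \<open>
  Polynomial functions in the coordinates; over an infinite field these correspond bijectively
  to formal polynomials. Closed sets are the common zero loci of arbitrary sets of them.
\<close>

inductive polynomial_map :: "('k::field ^ 'i \<Rightarrow> 'k) \<Rightarrow> bool" where
  const: "polynomial_map (\<lambda>x. c)"
| coord: "polynomial_map (\<lambda>x. x $ i)"
| add: "polynomial_map p \<Longrightarrow> polynomial_map q \<Longrightarrow> polynomial_map (\<lambda>x. p x + q x)"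
| mult: "polynomial_map p \<Longrightarrow> polynomial_map q \<Longrightarrow> polynomial_map (\<lambda>x. p x * q x)"

definition zero_locus :: "('k::field ^ 'i \<Rightarrow> 'k) set \<Rightarrow> ('k ^ 'i) set"
  where "zero_locus P = {x. \<forall>p\<in>P. p x = 0}"

definition zariski :: "('k::field ^ 'i) topology"
  where "zariski = topology (\<lambda>U. \<exists>P. (\<forall>p\<in>P. polynomial_map p) \<and> U = - zero_locus P)"

lemma istopology_zariski:
  "istopology (\<lambda>U :: ('k::field ^ 'i) set. \<exists>P. (\<forall>p\<in>P. polynomial_map p) \<and> U = - zero_locus P)"
  unfolding istopology_def
proof (intro conjI allI impI)
  fix S T :: "('k ^ 'i) set"
  assume "\<exists>P. (\<forall>p\<in>P. polynomial_map p) \<and> S = - zero_locus P"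
    and "\<exists>P. (\<forall>p\<in>P. polynomial_map p) \<and> T = - zero_locus P"
  then obtain P Q where
    P: "\<forall>p\<in>P. polynomial_map p" "S = - zero_locus P" and
    Q: "\<forall>p\<in>Q. polynomial_map p" "T = - zero_locus Q"
    by blast
  let ?R = "(\<lambda>(p, q) x. p x * q x) ` (P \<times> Q)"
  have "polynomial_map r" if "r \<in> ?R" for r
    using that P(1) Q(1) by (force intro: polynomial_map.mult)
  moreover have "S \<inter> T = - zero_locus ?R"
    unfolding P(2) Q(2) zero_locus_def by (auto simp: Bex_def Ball_def)
  ultimately show "\<exists>P. (\<forall>p\<in>P. polynomial_map p) \<and> S \<inter> T = - zero_locus P"
    by (intro exI[of _ ?R] conjI ballI)
next
  fix \<K> :: "('k ^ 'i) set set"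
  assume "\<forall>U\<in>\<K>. \<exists>P. (\<forall>p\<in>P. polynomial_map p) \<and> U = - zero_locus P"
  then obtain P where P: "\<forall>U\<in>\<K>. (\<forall>p\<in>P U. polynomial_map p) \<and> U = - zero_locus (P U)"
    by metis
  have "\<Union>\<K> = (\<Union>U\<in>\<K>. - zero_locus (P U))"
    using P by (metis (no_types, lifting) SUP_cong image_ident)
  also have "\<dots> = - zero_locus (\<Union>U\<in>\<K>. P U)"
    unfolding zero_locus_def by auto
  finally have "\<Union>\<K> = - zero_locus (\<Union>U\<in>\<K>. P U)" .
  moreover have "\<forall>p\<in>(\<Union>U\<in>\<K>. P U). polynomial_map p"
    using P by simp
  ultimately show "\<exists>P. (\<forall>p\<in>P. polynomial_map p) \<and> \<Union>\<K> = - zero_locus P"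
    by (intro exI[of _ "\<Union>U\<in>\<K>. P U"] conjI)
qed

lemma openin_zariski:
  "openin zariski U \<longleftrightarrow> (\<exists>P. (\<forall>p\<in>P. polynomial_map p) \<and> U = - zero_locus P)"
  unfolding zariski_def topology_inverse'[OF istopology_zariski] ..


section \<open>The variety of Lie brackets\<close>

definition lie_brackets :: "('k::field ^ 'n \<Rightarrow> 'k ^ 'n \<Rightarrow> 'k ^ 'n) set"
  where "lie_brackets = {\<mu>. lie_algebra (*s) \<mu>}"

definition structure_constants ::
    "('k::field ^ 'n \<Rightarrow> 'k ^ 'n \<Rightarrow> 'k ^ 'n) \<Rightarrow> 'k ^ ('n \<times> 'n \<times> 'n)"
  where "structure_constants \<mu> = (\<chi> t. case t of (i, j, k) \<Rightarrow> \<mu> (axis i 1) (axis j 1) $ k)"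

text \<open>
  The structure constants identify \<open>lie_brackets\<close> with a Zariski closed subset of the affine
  space of dimension \<open>n\<^sup>3\<close>; it carries the induced topology.
\<close>

definition lie_variety :: "('k::field ^ 'n \<Rightarrow> 'k ^ 'n \<Rightarrow> 'k ^ 'n) topology"
  where "lie_variety = pullback_topology lie_brackets structure_constants zariski"

definition GL_action ::
    "'k::field ^ 'n ^ 'n \<Rightarrow> ('k ^ 'n \<Rightarrow> 'k ^ 'n \<Rightarrow> 'k ^ 'n) \<Rightarrow> 'k ^ 'n \<Rightarrow> 'k ^ 'n \<Rightarrow> 'k ^ 'n"
  where "GL_action g \<mu> x y = g *v \<mu> (matrix_inv g *v x) (matrix_inv g *v y)"

definition GL_orbit ::
    "('k::field ^ 'n \<Rightarrow> 'k ^ 'n \<Rightarrow> 'k ^ 'n) \<Rightarrow> ('k ^ 'n \<Rightarrow> 'k ^ 'n \<Rightarrow> 'k ^ 'n) set"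
  where "GL_orbit \<mu> = {GL_action g \<mu> | g. invertible g}"

definition rigid :: "('k::field ^ 'n \<Rightarrow> 'k ^ 'n \<Rightarrow> 'k ^ 'n) \<Rightarrow> bool"
  where "rigid \<mu> \<longleftrightarrow> \<mu> \<in> lie_brackets \<and> openin lie_variety (GL_orbit \<mu>)"

definition non_rigid :: "('k::field ^ 'n \<Rightarrow> 'k ^ 'n \<Rightarrow> 'k ^ 'n) \<Rightarrow> bool"
  where "non_rigid \<mu> \<longleftrightarrow> \<mu> \<in> lie_brackets \<and> \<not> rigid \<mu>"

end

(* A linear functional f on g that vanishes on [g,g] is a character, so g acts on the abelian
   ideal by the scalars t * f, and the resulting semidirect products form a line of Lie brackets
   through the direct sum (t = 0). For t \<noteq> 0 and f \<noteq> 0 the derived algebra is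
   [g,g] + a, of strictly larger dimension than [g,g], so the line meets the orbit of the direct
   sum only at t = 0. As {0} is not Zariski open in an infinite field, the orbit is not open. *)

theory Submission
  imports Defs
begin

section \<open>Characters and semidirect products\<close>

text \<open>A basis of \<open>span S\<close> stays independent when \<open>x0\<close> is added, so
  values on the enlarged set can be prescribed freely. Applied to the brackets of a non-perfect
  algebra, this yields a nonzero character.\<close>

lemma (in vector_space) functional_vanishing_on_span:
  assumes "x0 \<notin> span S"
  obtains f where "Vector_Spaces.linear scale (*) f" "\<And>x. x \<in> span S \<Longrightarrow> f x = 0" "f x0 = 1"
proof -
  interpret F: vector_space_pair scale "(*)" ..
  obtain B where B: "B \<subseteq> span S" "independent B" "span S \<subseteq> span B"
    using maximal_independent_subset by blast
  have eq: "span B = span S"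
    using B span_minimal[OF B(1)] by (simp add: subset_antisym)
  have "independent (insert x0 B)"
    using assms B(2) eq by (intro independent_insertI) auto
  from F.linear_independent_extend[OF this, of "\<lambda>x. if x = x0 then 1 else 0"]
  obtain f where f: "Vector_Spaces.linear scale (*) f"
    "\<forall>x\<in>insert x0 B. f x = (if x = x0 then 1 else 0)" by blast
  have "x0 \<notin> B" using assms B(1) by blast
  then have "f x = 0" if "x \<in> B" for x using f(2) that by auto
  then have "f x = 0" if "x \<in> span S" for x
    using F.linear_eq_0_on_span[OF f(1)] that eq by auto
  moreover have "f x0 = 1" using f(2) by simp
  ultimately show thesis using that f(1) by blast
qed

text \<open>The semidirect product with an abelian ideal \<open>'w\<close> on which \<open>x\<close>
  acts as the scalar \<open>f x\<close>.\<close>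

definition character_extension ::
    "('k \<Rightarrow> 'w \<Rightarrow> 'w) \<Rightarrow> ('v \<Rightarrow> 'v \<Rightarrow> 'v) \<Rightarrow> ('v \<Rightarrow> 'k)
      \<Rightarrow> 'v \<times> 'w \<Rightarrow> 'v \<times> 'w \<Rightarrow> 'v \<times> 'w::ab_group_add"
  where "character_extension s b f u v =
    (b (fst u) (fst v), s (f (fst u)) (snd v) - s (f (fst v)) (snd u))"

text \<open>In the second component of the Jacobi sum, the terms with \<open>f (b x y)\<close>
  vanish by \<open>f0\<close>; the others cancel in pairs because scalars commute.\<close>

lemma lie_algebra_character_extension:
  fixes sv :: "'k::field \<Rightarrow> 'v::ab_group_add \<Rightarrow> 'v" and sw :: "'k \<Rightarrow> 'w::ab_group_add \<Rightarrow> 'w"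
  assumes b: "lie_algebra sv b" and w: "vector_space sw"
    and f: "Vector_Spaces.linear sv (*) f" and f0: "\<And>x y. f (b x y) = 0"
  shows "lie_algebra (module_prod.scale sv sw) (character_extension sw b f)"
proof -
  interpret B: lie_algebra sv b by fact
  interpret W: vector_space sw by fact
  interpret P: vector_space_prod sv sw ..
  have bl: "b (x + x') y = b x y + b x' y" "b (sv c x) y = sv c (b x y)"
    and br: "b x (y + y') = b x y + b x y'" "b x (sv c y) = sv c (b x y)" for c x x' y y'
    using B.linear_left[of y] B.linear_right[of x]
    by (simp_all add: Vector_Spaces.linear_iff)
  have fl: "f (x + y) = f x + f y" "f (sv c x) = c * f x" for c x y
    using f by (simp_all add: Vector_Spaces.linear_iff)
  show ?thesis
  proof (intro lie_algebra.intro lie_algebra_axioms.intro)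
    show "vector_space P.scale" ..
    show "Vector_Spaces.linear P.scale P.scale (\<lambda>x. character_extension sw b f x y)" for y
      by (auto simp: Vector_Spaces.linear_iff P.p.vector_space_axioms character_extension_def
          P.scale_def bl fl algebra_simps)
    show "Vector_Spaces.linear P.scale P.scale (\<lambda>y. character_extension sw b f x y)" for x
      by (auto simp: Vector_Spaces.linear_iff P.p.vector_space_axioms character_extension_def
          P.scale_def br fl algebra_simps)
    show "character_extension sw b f x y = - character_extension sw b f y x" for x y
      using B.antisym[of "fst x" "fst y"] by (simp add: character_extension_def)
    show "character_extension sw b f x (character_extension sw b f y z) +
      character_extension sw b f y (character_extension sw b f z x) +
      character_extension sw b f z (character_extension sw b f x y) = 0" for x y z
      using B.jacobi[of "fst x" "fst y" "fst z"]
      by (simp add: character_extension_def f0 zero_prod_def algebra_simps)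
  qed
qed

section \<open>Transport of brackets to coordinates\<close>

lemma bracket_in_coordinates_phi:
  "bij \<phi> \<Longrightarrow> bracket_in_coordinates \<phi> b (\<phi> u) (\<phi> v) = \<phi> (b u v)"
  by (simp add: bracket_in_coordinates_def bij_is_inj)

lemma lie_algebra_bracket_in_coordinates:
  fixes \<phi> :: "'v::ab_group_add \<Rightarrow> 'k::field ^ 'n"
  assumes b: "lie_algebra s b" and \<phi>: "coordinate_iso s \<phi>"
  shows "lie_algebra (*s) (bracket_in_coordinates \<phi> b)"
proof -
  interpret B: lie_algebra s b by fact
  have bij: "bij \<phi>" and lin: "Vector_Spaces.linear s (*s) \<phi>"
    using \<phi> by (auto simp: coordinate_iso_def)
  interpret L: Vector_Spaces.linear s "(*s)" \<phi> by fact
  have bl: "b (x + x') y = b x y + b x' y" "b (s c x) y = s c (b x y)"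
    and br: "b x (y + y') = b x y + b x y'" "b x (s c y) = s c (b x y)" for c x x' y y'
    using B.linear_left[of y] B.linear_right[of x]
    by (simp_all add: Vector_Spaces.linear_iff)
  let ?\<mu> = "bracket_in_coordinates \<phi> b"
  \<comment> \<open>Once every vector is written as \<open>\<phi> u\<close>, these rules gather each
    side under a single \<open>\<phi>\<close>, so each law reduces to the one for
    \<open>b\<close>.\<close>
  note simps = bracket_in_coordinates_phi[OF bij] L.add[symmetric] L.scale[symmetric] bl br
  have surj: "\<exists>u. x = \<phi> u" for x using bij by (metis bij_pointE)
  show ?thesis
  proof (intro lie_algebra.intro lie_algebra_axioms.intro)
    show "vector_space ((*s) :: 'k \<Rightarrow> 'k ^ 'n \<Rightarrow> _)" ..
    show "Vector_Spaces.linear (*s) (*s) (\<lambda>x. ?\<mu> x y)" for y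
      unfolding Vector_Spaces.linear_iff
    proof (intro conjI allI)
      show "?\<mu> (x + x') y = ?\<mu> x y + ?\<mu> x' y" for x x'
        using surj[of x] surj[of x'] surj[of y] by (auto simp: simps)
      show "?\<mu> (c *s x) y = c *s ?\<mu> x y" for c x
        using surj[of x] surj[of y] by (auto simp: simps)
    qed (rule vec.vector_space_axioms)+
    show "Vector_Spaces.linear (*s) (*s) (\<lambda>y. ?\<mu> x y)" for x
      unfolding Vector_Spaces.linear_iff
    proof (intro conjI allI)
      show "?\<mu> x (y + y') = ?\<mu> x y + ?\<mu> x y'" for y y'
        using surj[of x] surj[of y'] surj[of y] by (auto simp: simps)
      show "?\<mu> x (c *s y) = c *s ?\<mu> x y" for c y
        using surj[of x] surj[of y] by (auto simp: simps)
    qed (rule vec.vector_space_axioms)+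
    show "?\<mu> x y = - ?\<mu> y x" for x y
      using B.antisym by (metis L.neg bracket_in_coordinates_def)
    show "?\<mu> x (?\<mu> y z) + ?\<mu> y (?\<mu> z x) + ?\<mu> z (?\<mu> x y) = 0" for x y z
      using surj[of x] surj[of y] surj[of z] by (auto simp: simps B.jacobi L.zero)
  qed
qed

section \<open>An isomorphism invariant of brackets\<close>

lemma matrix_inv_invertible:
  assumes "invertible A"
  shows "A ** matrix_inv A = mat 1 \<and> matrix_inv A ** A = mat 1"
  using assms unfolding invertible_def matrix_inv_def by (rule someI_ex)

text \<open>\<open>A\<close> is an isomorphism from \<open>\<mu>\<close> to
  \<open>GL_action A \<mu>\<close>, so it carries brackets to brackets, and linear images commute
  with spans.\<close>

lemma derived_algebra_GL_action:
  fixes \<mu> :: "'k::field ^ 'n \<Rightarrow> 'k ^ 'n \<Rightarrow> 'k ^ 'n"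
  assumes "invertible A"
  shows "derived_algebra (*s) (GL_action A \<mu>) = (*v) A ` derived_algebra (*s) \<mu>"
proof -
  have inv: "matrix_inv A *v (A *v x) = x" for x
    using assms by (simp add: matrix_vector_mul_assoc matrix_inv_invertible)
  have "{GL_action A \<mu> x y |x y. True} = (*v) A ` {\<mu> x y |x y. True}" (is "?l = ?r")
  proof
    show "?l \<subseteq> ?r" by (auto simp: GL_action_def)
    show "?r \<subseteq> ?l"
    proof clarify
      fix x y
      have "A *v \<mu> x y = GL_action A \<mu> (A *v x) (A *v y)" by (simp add: GL_action_def inv)
      then show "\<exists>x' y'. A *v \<mu> x y = GL_action A \<mu> x' y' \<and> True" by blast
    qed
  qed
  then show ?thesis
    unfolding derived_algebra_def
    by (simp add: vec.linear_span_image[OF matrix_vector_mul_linear_gen])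
qed

text \<open>The invariant that will separate the line from the orbit; it is preserved because an
  invertible matrix acts injectively.\<close>

lemma dim_derived_algebra_GL_orbit:
  fixes \<mu> :: "'k::field ^ 'n \<Rightarrow> 'k ^ 'n \<Rightarrow> 'k ^ 'n"
  assumes "\<nu> \<in> GL_orbit \<mu>"
  shows "vec.dim (derived_algebra (*s) \<nu>) = vec.dim (derived_algebra (*s) \<mu>)"
proof -
  obtain A where A: "invertible A" "\<nu> = GL_action A \<mu>"
    using assms by (auto simp: GL_orbit_def)
  have "inj ((*v) A)"
    using A(1) by (rule inj_matrix_vector_mult)
  then show ?thesis
    unfolding A(2) derived_algebra_GL_action[OF A(1)]
    by (intro vec.dim_image_eq matrix_vector_mul_linear_gen) (auto intro: inj_on_subset)
qed

section \<open>Lines in the Zariski topology\<close>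

lemma polynomial_map_on_line:
  assumes "polynomial_map p"
  shows "\<exists>q. \<forall>t. p (c + t *s d) = poly q t"
  using assms
proof induction
  case (const a)
  show ?case by (rule exI[of _ "[:a:]"]) simp
next
  case (coord i)
  show ?case by (rule exI[of _ "[:c $ i, d $ i:]"]) simp
next
  case (add p q)
  then show ?case by (metis poly_add)
next
  case (mult p q)
  then show ?case by (metis poly_mult)
qed

text \<open>Some polynomial is nonzero at \<open>c\<close> and vanishes off \<open>U\<close>. Its
  restriction to the line has finitely many roots, while a field of characteristic zero is
  infinite.\<close>

lemma zariski_open_on_line:
  fixes c d :: "'k::field_char_0 ^ 'i"
  assumes "openin zariski U" "c \<in> U"
  shows "\<exists>t. t \<noteq> 0 \<and> c + t *s d \<in> U"
proof -
  obtain p where p: "polynomial_map p" "p c \<noteq> 0" "\<And>x. p x \<noteq> 0 \<Longrightarrow> x \<in> U"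
    using assms unfolding openin_zariski zero_locus_def by auto
  obtain q where q: "\<And>t. p (c + t *s d) = poly q t"
    using polynomial_map_on_line[OF p(1)] by metis
  \<comment> \<open>The parameter 0 is the point \<open>c\<close>, so \<open>q\<close> is not the
    zero polynomial.\<close>
  have "poly q 0 \<noteq> 0" using p(2) q[of 0] by simp
  then have "finite {t. poly q t = 0}" by (intro poly_roots_finite) auto
  then have "finite (insert 0 {t. poly q t = 0})" by simp
  then obtain t where "t \<notin> insert 0 {t. poly q t = 0}"
    using ex_new_if_finite[OF infinite_UNIV_char_0] by blast
  then show ?thesis using p(3) q by auto
qed

lemma GL_orbit_refl:
  fixes \<mu> :: "'k::field ^ 'n \<Rightarrow> 'k ^ 'n \<Rightarrow> 'k ^ 'n"
  shows "\<mu> \<in> GL_orbit \<mu>"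
proof -
  have inv1: "invertible (mat 1 :: 'k ^ 'n ^ 'n)"
    unfolding invertible_def by (intro exI[of _ "mat 1"]) simp
  from matrix_inv_invertible[OF this] have "matrix_inv (mat 1 :: 'k ^ 'n ^ 'n) = mat 1"
    by simp
  then have "GL_action (mat 1) \<mu> = \<mu>" by (simp add: GL_action_def fun_eq_iff)
  then show ?thesis
    unfolding GL_orbit_def by (metis (mono_tags, lifting) inv1 mem_Collect_eq)
qed

text \<open>An open orbit is cut out by a Zariski open set of structure constants, and there the
  family is a straight line through a point of that set.\<close>

lemma rigid_on_line:
  fixes M :: "'k::field_char_0 \<Rightarrow> 'k ^ 'n \<Rightarrow> 'k ^ 'n \<Rightarrow> 'k ^ 'n"
  assumes "rigid (M 0)" "\<And>t. M t \<in> lie_brackets"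
    and line: "\<And>t. structure_constants (M t) = c + t *s d"
  shows "\<exists>t. t \<noteq> 0 \<and> M t \<in> GL_orbit (M 0)"
proof -
  obtain U where U: "openin zariski U"
    "GL_orbit (M 0) = structure_constants -` U \<inter> lie_brackets"
    using assms(1) unfolding rigid_def lie_variety_def openin_pullback_topology by blast
  have "structure_constants (M 0) \<in> U" using GL_orbit_refl[of "M 0"] U(2) by blast
  then have "c \<in> U" using line[of 0] by simp
  from zariski_open_on_line[OF U(1) this, of d] show ?thesis
    using U(2) assms(2) line by (metis IntI vimageI)
qed

section \<open>The line of brackets through the direct sum\<close>

theorem theorem6p3:
  fixes sg :: "'k::{alg_closed_field, field_char_0} \<Rightarrow> 'g::ab_group_add \<Rightarrow> 'g"
    and g :: "'g \<Rightarrow> 'g \<Rightarrow> 'g"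
    and sa :: "'k \<Rightarrow> 'a::ab_group_add \<Rightarrow> 'a"
    and a :: "'a \<Rightarrow> 'a \<Rightarrow> 'a"
    and m l :: nat
    and \<phi> :: "'g \<times> 'a \<Rightarrow> 'k ^ 'n"
  assumes "lie_algebra sg g" and "has_dimension sg m" and "\<not> perfect sg g"
    and "lie_algebra sa a" and "has_dimension sa l" and "abelian a" and "l \<ge> 1"
    and "CARD('n) = m + l"
    and "coordinate_iso (module_prod.scale sg sa) \<phi>"
  shows "non_rigid (bracket_in_coordinates \<phi> (direct_sum_bracket g a))"
proof -
  interpret G: lie_algebra sg g by fact
  interpret A: lie_algebra sa a by fact
  interpret P: vector_space_prod sg sa ..
  have bij: "bij \<phi>" and lin: "Vector_Spaces.linear P.scale (*s) \<phi>"
    using assms(9) by (auto simp: coordinate_iso_def)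
  interpret L: Vector_Spaces.linear P.scale "(*s)" \<phi> by fact
  obtain x0 where x0: "x0 \<notin> G.span {g x y | x y. True}"
    using assms(3) by (auto simp: perfect_def derived_algebra_def)
  obtain f where f: "Vector_Spaces.linear sg (*) f"
    and f_span: "\<And>x. x \<in> G.span {g x y | x y. True} \<Longrightarrow> f x = 0"
    and f_x0: "f x0 = 1"
    by (rule G.functional_vanishing_on_span[OF x0]) blast
  have f0: "f (g x y) = 0" for x y by (rule f_span, rule G.span_base) blast
  \<comment> \<open>Since \<open>l \<ge> 1\<close>, a basis of the abelian summand is nonempty, and
    its elements are nonzero.\<close>
  obtain v0 :: 'a where v0: "v0 \<noteq> 0"
  proof -
    obtain B where B: "finite_dimensional_vector_space sa B" "card B = l"
      using assms(5) by (auto simp: has_dimension_def)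
    then have "A.independent B"
      by (simp add: finite_dimensional_vector_space.independent_Basis)
    moreover have "B \<noteq> {}" using B(2) assms(7) by auto
    ultimately show thesis using that A.dependent_zero by (metis ex_in_conv)
  qed
  define b where "b = (\<lambda>t. character_extension sa g (\<lambda>x. t * f x))"
  define M where "M = (\<lambda>t. bracket_in_coordinates \<phi> (b t))"
  have tf: "Vector_Spaces.linear sg (*) (\<lambda>x. t * f x)" for t
    using f by (simp add: Vector_Spaces.linear_iff algebra_simps)
  have M_lie: "M t \<in> lie_brackets" for t
    unfolding M_def b_def lie_brackets_def mem_Collect_eq
    by (intro lie_algebra_bracket_in_coordinates[OF _ assms(9)]
        lie_algebra_character_extension[OF assms(1) _ tf] A.vector_space_axioms) (simp add: f0)
  have b0: "b 0 = direct_sum_bracket g a"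
    using assms(6)
    by (simp add: fun_eq_iff b_def character_extension_def direct_sum_bracket_def abelian_def)
  \<comment> \<open>The character enters the bracket linearly, so scaling it by \<open>t\<close>
    makes the bracket affine in \<open>t\<close>.\<close>
  have M_line: "M t x y = M 0 x y + t *s (M 1 x y - M 0 x y)" for t x y
  proof -
    have "b t u v = b 0 u v + P.scale t (b 1 u v - b 0 u v)" for u v
      by (simp add: b_def character_extension_def P.scale_def A.scale_right_diff_distrib)
    then show ?thesis
      by (simp add: M_def bracket_in_coordinates_def L.add L.scale L.diff)
  qed
  have sc: "structure_constants (M t) = structure_constants (M 0) +
      t *s (structure_constants (M 1) - structure_constants (M 0))" for t
    \<comment> \<open>A single rewrite with \<open>M_line\<close>: its right side contains further
      instances of its left side, so simplification with it would loop.\<close>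
    by (subst (1) structure_constants_def, subst M_line)
      (simp add: vec_eq_iff structure_constants_def split: prod.splits)
  have not_orbit: "M t \<notin> GL_orbit (M 0)" if t: "t \<noteq> 0" for t
  proof
    assume "M t \<in> GL_orbit (M 0)"
    from dim_derived_algebra_GL_orbit[OF this]
    have dim: "vec.dim (derived_algebra (*s) (M t)) = vec.dim (derived_algebra (*s) (M 0))" .
    have M\<phi>: "M t (\<phi> u) (\<phi> v) = \<phi> (b t u v)" for t u v
      by (simp add: M_def bracket_in_coordinates_phi[OF bij])
    have in_D: "\<phi> (b t u v) \<in> derived_algebra (*s) (M t)" for t u v
      unfolding derived_algebra_def using M\<phi>[of t u v]
      by (intro vec.span_base) (metis (mono_tags, lifting) mem_Collect_eq)
    have M0: "M 0 x y = \<phi> (g (fst (inv \<phi> x)) (fst (inv \<phi> y)), 0)" for x y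
      by (simp add: M_def bracket_in_coordinates_def b_def character_extension_def)
    \<comment> \<open>On arguments with zero second component the character terms vanish, so
      \<open>b t\<close> takes the values of \<open>b 0\<close>.\<close>
    have "M 0 x y \<in> derived_algebra (*s) (M t)" for x y
      using in_D[of t "(fst (inv \<phi> x), 0)" "(fst (inv \<phi> y), 0)"]
      by (simp add: M0 b_def character_extension_def)
    then have sub: "derived_algebra (*s) (M 0) \<subseteq> derived_algebra (*s) (M t)"
      by (subst derived_algebra_def, intro vec.span_minimal)
        (auto simp: derived_algebra_def)
    have "\<phi> (0, v0) \<in> derived_algebra (*s) (M t)"
    proof -
      \<comment> \<open>As \<open>f x0 = 1\<close>, the vector \<open>sg (1 / t) x0\<close> acts on
        the ideal by \<open>t * f (sg (1 / t) x0) = 1\<close>, that is, as the identity.\<close>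
      have "b t (sg (1 / t) x0, 0) (0, v0) = (0, v0)"
      proof -
        interpret F: Vector_Spaces.linear sg "(*)" f by (rule f)
        have "g z 0 = 0" for z
        proof -
          interpret H: Vector_Spaces.linear sg sg "g z" by (rule G.linear_right)
          show ?thesis by (rule H.zero)
        qed
        then show ?thesis
          using t by (simp add: b_def character_extension_def F.scale F.zero f_x0)
      qed
      then show ?thesis using in_D[of t "(sg (1 / t) x0, 0)" "(0, v0)"] by simp
    qed
    moreover have "\<phi> (0, v0) \<notin> derived_algebra (*s) (M 0)"
    proof -
      \<comment> \<open>For \<open>t = 0\<close> all brackets lie in the summand \<open>'g\<close>,
        whose image under \<open>\<phi>\<close> misses \<open>\<phi> (0, v0)\<close>.\<close>
      have "P.p.subspace (UNIV \<times> {0})"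
        by (intro P.subspace_Times) auto
      then have "vec.subspace (\<phi> ` (UNIV \<times> {0}))"
        by (rule L.subspace_image)
      then have "derived_algebra (*s) (M 0) \<subseteq> \<phi> ` (UNIV \<times> {0})"
        unfolding derived_algebra_def by (intro vec.span_minimal) (auto simp: M0)
      moreover have "\<phi> (0, v0) \<notin> \<phi> ` (UNIV \<times> {0})"
        using v0 by (simp add: inj_image_mem_iff[OF bij_is_inj[OF bij]])
      ultimately show ?thesis by blast
    qed
    ultimately have "derived_algebra (*s) (M 0) \<subset> derived_algebra (*s) (M t)"
      using sub by blast
    \<comment> \<open>Both derived algebras are their own spans, so strict inclusion forces a strict
      inequality of dimensions.\<close>
    then have "vec.dim (derived_algebra (*s) (M 0)) < vec.dim (derived_algebra (*s) (M t))"
      by (intro vec.dim_psubset) (simp add: derived_algebra_def vec.span_span)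
    then show False using dim by simp
  qed
  have "\<not> rigid (M 0)"
    using rigid_on_line[of M, OF _ M_lie sc] not_orbit by blast
  then show ?thesis
    using M_lie[of 0] by (simp add: non_rigid_def M_def b0)
qed

end
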